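(* Let $n\ge 1$ be an integer. Define polynomials $q_0,\dots,q_n$ by $q_0(x)=1$, $q_1(x)=x$ and $x\,q_j(x)=(j+1)\,q_{j+1}(x)+(n-j+1)\,q_{j-1}(x)$ for $1\le j\le n-1$. For $j\in[0,n]$ and $i\in[0,j]$ let $L_i(j)$ denote the coefficient of $x^{j-i}$ in $q_j(x)$. Then $$L_i(j)=\begin{cases}0,& i\text{ odd},\\[2pt] \dfrac{(-1)^{i/2}}{j!}\displaystyle\sum_{I\in\mathcal{I}(i/2,j)}R(I),& i\text{ even}.\end{cases}$$
   Context: A finite set of integers $\{u_1<\dots<u_k\}$ is called $2$-separated if $u_{l+1}-u_l\ge 2$ for all $l\in[k-1]$. For integers $k\ge0$ and $j$, $\mathcal{I}(k,j)$ denotes the set of all $k$-element subsets of $\{0,1,\dots,j-2\}$ that are $2$-separated (so $\mathcal{I}(0,j)=\{\emptyset\}$). For such $I$, $R(I)=\prod_{i\in I}(n-i)(i+1)$, with $R(\emptyset)=1$. *)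

theory Defs
  imports Complex_Main "HOL-Computational_Algebra.Polynomial"
begin

definition two_separated :: "int set \<Rightarrow> bool" where
  "two_separated U \<longleftrightarrow> finite U \<and>
     (\<forall>l. Suc l < card U \<longrightarrow>
        sorted_list_of_set U ! Suc l - sorted_list_of_set U ! l \<ge> 2)"

text \<open>The index \<open>j\<close> is an integer so that the range \<open>{0..j - 2}\<close> is empty for \<open>j \<le> 1\<close>;
  truncated subtraction on the naturals would wrongly admit the element 0.\<close>

definition sep_sets :: "nat \<Rightarrow> int \<Rightarrow> int set set" where
  "sep_sets k j = {I. I \<subseteq> {0..j - 2} \<and> card I = k \<and> two_separated I}"

definition R :: "int \<Rightarrow> int set \<Rightarrow> int" where
  "R n I = (\<Prod>i\<in>I. (n - i) * (i + 1))"

end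

(* Both sides satisfy the same three-term recurrence.  Splitting the 2-separated subsets of
   {0, ..., j} according to whether they contain j shows that the sums S k j of R(I) over the
   k-element 2-separated subsets I of {0, ..., j - 2} satisfy
   S (k + 1) (j + 2) = S (k + 1) (j + 1) + (n - j) (j + 1) S k j, while the recurrence for the
   polynomials j! q_j has the same weights up to sign. *)

theory Submission
  imports Defs
begin

text \<open>Neighbouring entries of a strictly increasing integer list differ by at least 1, so a
  gap below 2 can only be the gap 1. The pointwise condition is easy to follow when one element is
  inserted or removed, unlike positions in the sorted list.\<close>

lemma two_separated_iff:
  "two_separated U \<longleftrightarrow> finite U \<and> (\<forall>x\<in>U. x + 1 \<notin> U)"
proof (cases "finite U")
  case fin: True
  define xs where "xs = sorted_list_of_set U"
  have sorted: "sorted_wrt (<) xs" and set: "set xs = U" and len: "length xs = card U"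
    using fin by (simp_all add: xs_def)
  have "(\<forall>l. Suc l < card U \<longrightarrow> xs ! Suc l - xs ! l \<ge> 2) \<longleftrightarrow> (\<forall>x\<in>U. x + 1 \<notin> U)"
  proof (intro iffI allI impI ballI notI)
    fix x assume gap: "\<forall>l. Suc l < card U \<longrightarrow> xs ! Suc l - xs ! l \<ge> 2" and "x \<in> U" "x + 1 \<in> U"
    then obtain a b where a: "a < length xs" "xs ! a = x" and b: "b < length xs" "xs ! b = x + 1"
      unfolding set[symmetric] by (metis in_set_conv_nth)
    have "a < b"
      using sorted_wrt_nth_less[OF sorted, of b a] a b by (cases a b rule: linorder_cases) auto
    \<comment> \<open>The entry right after \<open>x\<close> is at most \<open>x + 1\<close>, so
      already this adjacent pair violates the gap condition.\<close>
    then have "xs ! Suc a \<le> xs ! b"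
      using sorted_wrt_nth_less[OF sorted, of "Suc a" b] b by (cases "Suc a = b") auto
    moreover have "xs ! Suc a - xs ! a \<ge> 2"
      using gap \<open>a < b\<close> b len by simp
    ultimately show False
      using a b by simp
  next
    fix l assume sep: "\<forall>x\<in>U. x + 1 \<notin> U" and l: "Suc l < card U"
    have "xs ! l < xs ! Suc l"
      using sorted_wrt_nth_less[OF sorted, of l "Suc l"] l len by simp
    moreover have "xs ! Suc l \<noteq> xs ! l + 1"
      using sep l len set by (metis Suc_lessD nth_mem)
    ultimately show "xs ! Suc l - xs ! l \<ge> 2"
      by linarith
  qed
  with fin show ?thesis
    by (simp add: two_separated_def xs_def)
qed (simp add: two_separated_def)

lemma sep_sets_eq:
  "sep_sets k j = {I. I \<subseteq> {0..j - 2} \<and> card I = k \<and> (\<forall>x\<in>I. x + 1 \<notin> I)}"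
  by (auto simp: sep_sets_def two_separated_iff intro: finite_subset)

lemma finite_sep_sets: "finite (sep_sets k j)"
  by (rule finite_subset[of _ "Pow {0..j - 2}"]) (auto simp: sep_sets_def)

lemma sep_sets_0: "sep_sets 0 j = {{}}"
  by (auto simp: sep_sets_eq dest: finite_subset)

lemma sep_sets_Suc_empty:
  assumes "j \<le> 1"
  shows "sep_sets (Suc k) j = {}"
  using assms by (auto simp: sep_sets_eq)

text \<open>A set with largest possible element \<open>j\<close> must omit \<open>j - 1\<close>, so
  deleting \<open>j\<close> leaves a subset of \<open>{0..j - 2}\<close>; a set without
  \<open>j\<close> lies in \<open>{0..j - 1}\<close>. For \<open>j \<ge> 0\<close> the new element
  \<open>j\<close> belongs to the ground set \<open>{0..j}\<close>.\<close>

lemma sep_sets_Suc: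
  assumes "j \<ge> 0"
  shows "sep_sets (Suc k) (j + 2) = sep_sets (Suc k) (j + 1) \<union> insert j ` sep_sets k j"
proof (intro equalityI subsetI)
  fix I assume I: "I \<in> sep_sets (Suc k) (j + 2)"
  then have sub: "I \<subseteq> {0..j}" and card: "card I = Suc k" and sep: "\<And>x. x \<in> I \<Longrightarrow> x + 1 \<notin> I"
    by (auto simp: sep_sets_eq)
  have fin: "finite I"
    using sub by (rule finite_subset) simp
  show "I \<in> sep_sets (Suc k) (j + 1) \<union> insert j ` sep_sets k j"
  proof (cases "j \<in> I")
    case True
    have "x \<le> j - 2" if "x \<in> I - {j}" for x
    proof -
      have "x \<noteq> j - 1" using sep[of x] that True by auto
      with that sub show ?thesis by force
    qed
    then have "I - {j} \<in> sep_sets k j"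
      using sub card sep True fin by (force simp: sep_sets_eq)
    moreover have "I = insert j (I - {j})" using True by auto
    ultimately show ?thesis by blast
  next
    case False
    then have "x \<le> j - 1" if "x \<in> I" for x
      using that sub by (cases "x = j") force+
    then have "I \<in> sep_sets (Suc k) (j + 1)"
      using sub card sep by (auto simp: sep_sets_eq)
    then show ?thesis by simp
  qed
next
  fix I assume "I \<in> sep_sets (Suc k) (j + 1) \<union> insert j ` sep_sets k j"
  then show "I \<in> sep_sets (Suc k) (j + 2)"
  proof
    assume "I \<in> sep_sets (Suc k) (j + 1)"
    then show ?thesis by (force simp: sep_sets_eq)
  next
    assume "I \<in> insert j ` sep_sets k j"
    then obtain J where J: "I = insert j J" "J \<subseteq> {0..j - 2}" "card J = k" "\<forall>x\<in>J. x + 1 \<notin> J"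
      by (auto simp: sep_sets_eq)
    have "finite J" using J(2) by (rule finite_subset) simp
    \<comment> \<open>All elements of \<open>J\<close> are at most \<open>j - 2\<close>, so
      \<open>j\<close> is new and adjacent to none of them.\<close>
    moreover have "j \<notin> J" "j + 1 \<notin> J" "\<And>x. x \<in> J \<Longrightarrow> x + 1 \<noteq> j" using J(2) by force+
    ultimately show ?thesis using J assms by (force simp: sep_sets_eq)
  qed
qed

definition sep_sum :: "int \<Rightarrow> nat \<Rightarrow> int \<Rightarrow> int" where
  "sep_sum n k j = (\<Sum>I\<in>sep_sets k j. R n I)"

lemma sep_sum_0: "sep_sum n 0 j = 1"
  by (simp add: sep_sum_def sep_sets_0 R_def)

lemma sep_sum_Suc:
  assumes "j \<ge> 0"
  shows "sep_sum n (Suc k) (j + 2) =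
    sep_sum n (Suc k) (j + 1) + (n - j) * (j + 1) * sep_sum n k j"
proof -
  have notin: "j \<notin> I" and fin: "finite I" if "I \<in> sep_sets k j" for I
    using that by (auto simp: sep_sets_eq dest: finite_subset)
  have inj: "inj_on (insert j) (sep_sets k j)"
    using notin by (intro inj_onI) (metis insert_ident)
  \<comment> \<open>Sets of the first family stay within \<open>{0..j - 1}\<close>, while those of
    the second contain \<open>j\<close>.\<close>
  have "sep_sets (Suc k) (j + 1) \<inter> insert j ` sep_sets k j = {}"
    by (auto simp: sep_sets_eq)
  then have "sep_sum n (Suc k) (j + 2) =
      sep_sum n (Suc k) (j + 1) + (\<Sum>I\<in>insert j ` sep_sets k j. R n I)"
    unfolding sep_sum_def sep_sets_Suc[OF assms]
    by (intro sum.union_disjoint) (simp_all add: finite_sep_sets)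
  also have "(\<Sum>I\<in>insert j ` sep_sets k j. R n I) = (\<Sum>I\<in>sep_sets k j. (n - j) * (j + 1) * R n I)"
    unfolding sum.reindex[OF inj] by (intro sum.cong) (simp_all add: R_def notin fin)
  finally show ?thesis
    by (simp add: sep_sum_def sum_distrib_left)
qed

text \<open>Fitting \<open>k\<close> elements with gaps at least 2 takes \<open>2 * k - 1\<close>
  consecutive integers, but only \<open>j - 1\<close> are available. The proof avoids counting: both
  terms of the recurrence inherit the inequality. This settles the constant coefficient in the
  recurrence for \<open>sep_coeff\<close>.\<close>

lemma sep_sum_eq_0: "j < 2 * k \<Longrightarrow> sep_sum n k (int j) = 0"
proof (induction j arbitrary: k rule: less_induct)
  case (less j)
  then obtain l where l: "k = Suc l" by (cases k) auto
  show ?case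
  proof (cases "j \<le> 1")
    case True
    then show ?thesis by (simp add: l sep_sum_def sep_sets_Suc_empty)
  next
    case False
    then obtain i where i: "j = i + 2" by (metis add.commute le_Suc_ex not_less_eq_eq one_add_one plus_1_eq_Suc)
    have "sep_sum n (Suc l) (int (i + 1)) = 0" "sep_sum n l (int i) = 0"
      using less.IH[of "i + 1" "Suc l"] less.IH[of i l] less.prems l i by simp_all
    then show ?thesis
      using sep_sum_Suc[of "int i" n l] by (simp add: l i add.commute)
  qed
qed

text \<open>The coefficient of \<open>x ^ m\<close> in \<open>j! q\<^sub>j\<close>.\<close>

definition sep_coeff :: "int \<Rightarrow> nat \<Rightarrow> nat \<Rightarrow> int" where
  "sep_coeff n j m =
    (if j < m \<or> odd (j - m) then 0
     else (- 1) ^ ((j - m) div 2) * sep_sum n ((j - m) div 2) (int j))"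

text \<open>This is the coefficient form of
  \<open>p (j + 2) = x * p (j + 1) - (n - j) * (j + 1) * p j\<close>, which
  \<open>p j = j! * q j\<close> satisfies; the case distinction on \<open>m\<close> is
  multiplication by \<open>x\<close>.\<close>

lemma sep_coeff_Suc_Suc:
  "sep_coeff n (j + 2) m =
    (case m of 0 \<Rightarrow> 0 | Suc l \<Rightarrow> sep_coeff n (j + 1) l)
      - (n - int j) * (int j + 1) * sep_coeff n j m"
proof -
  \<comment> \<open>Only the last case needs the recurrence for \<open>sep_sum\<close>; the others
    reduce to vanishing coefficients or to the leading coefficient 1.\<close>
  consider "j + 2 < m" | "m = j + 2" | "m = j + 1" | i where "j = m + i" "odd i"
    | k where "j = m + 2 * k"
    by (metis Suc_eq_plus1 add_2_eq_Suc' evenE le_Suc_ex less_antisym not_less_eq linorder_not_less)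
  then show ?thesis
  proof cases
    case (5 k)
    have rec: "sep_sum n (Suc k) (int (j + 2)) =
        sep_sum n (Suc k) (int (j + 1)) + (n - int j) * (int j + 1) * sep_sum n k (int j)"
      using sep_sum_Suc[of "int j" n k] by (simp add: add.commute)
    have half: "(j - m) div 2 = k" "(j + 2 - m) div 2 = Suc k" "even (j - m)" "even (j + 2 - m)"
      using 5 by auto
    have lead: "(case m of 0 \<Rightarrow> 0 | Suc l \<Rightarrow> sep_coeff n (j + 1) l) =
        (- 1) ^ Suc k * sep_sum n (Suc k) (int (j + 1))"
    proof (cases m)
      case 0
      \<comment> \<open>Multiplication by \<open>x\<close> leaves no constant term; here
        \<open>j = 2 * k\<close>, so \<open>j + 1 < 2 * Suc k\<close> and the sum on the right
        vanishes as well.\<close>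
      then show ?thesis using 5 sep_sum_eq_0[of "j + 1" "Suc k" n] by simp
    next
      case (Suc l)
      then have "j + 1 - l = 2 * Suc k" using 5 by simp
      then show ?thesis using Suc 5 by (simp add: sep_coeff_def)
    qed
    have "sep_coeff n j m = (- 1) ^ k * sep_sum n k (int j)"
      using 5 half by (simp add: sep_coeff_def)
    moreover have "sep_coeff n (j + 2) m = (- 1) ^ Suc k * sep_sum n (Suc k) (int (j + 2))"
      using 5(1) half by (simp only: sep_coeff_def) simp
    ultimately show ?thesis
      by (simp only: lead rec) (simp only: power_Suc algebra_simps)
  qed (auto simp: sep_coeff_def sep_sum_0 split: nat.split)
qed

theorem theorem1:
  fixes n :: nat and q :: "nat \<Rightarrow> real poly"
  assumes "n \<ge> 1"
    and "q 0 = 1"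
    and "q 1 = [:0, 1:]"
    and "\<And>j. 1 \<le> j \<Longrightarrow> j \<le> n - 1 \<Longrightarrow>
           [:0, 1:] * q j
             = smult (real j + 1) (q (j + 1)) + smult (real n - real j + 1) (q (j - 1))"
  shows "\<forall>j\<in>{0..n}. \<forall>i\<in>{0..j}.
           coeff (q j) (j - i) =
             (if odd i then 0
              else (- 1) ^ (i div 2) / fact j
                     * (\<Sum>I\<in>sep_sets (i div 2) (int j). real_of_int (R (int n) I)))"
proof -
  \<comment> \<open>Clearing the factorial keeps the right side integral, and letting
    \<open>m\<close> be arbitrary covers coefficients beyond the degree, which the recurrence also
    meets.\<close>
  have main: "fact j * coeff (q j) m = real_of_int (sep_coeff (int n) j m)" if "j \<le> n" for j m
    using that
  proof (induction j arbitrary: m rule: less_induct)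
    case (less j)
    consider "j = 0" | "j = 1" | i where "j = i + 2"
      by (metis One_nat_def add_2_eq_Suc' not0_implies_Suc)
    then show ?case
    proof cases
      case 1
      then show ?thesis by (simp add: assms sep_coeff_def sep_sum_0)
    next
      case 2
      have "m = 0 \<or> m = 1 \<or> m > 1" by linarith
      then show ?thesis
        using 2 assms(3) by (auto simp: sep_coeff_def sep_sum_0 coeff_pCons split: nat.split)
    next
      case (3 i)
      have "[:0, 1:] * q (i + 1) = smult (real i + 2) (q (i + 2)) + smult (real n - real i) (q i)"
        using assms(4)[of "i + 1"] less.prems 3 by (simp add: add.commute)
      then have "coeff ([:0, 1:] * q (i + 1)) m =
          (real i + 2) * coeff (q (i + 2)) m + (real n - real i) * coeff (q i) m"
        by (metis coeff_add coeff_smult)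
      then have "(real i + 2) * coeff (q (i + 2)) m =
          (case m of 0 \<Rightarrow> 0 | Suc l \<Rightarrow> coeff (q (i + 1)) l) - (real n - real i) * coeff (q i) m"
        by (cases m) (simp_all add: coeff_pCons)
      \<comment> \<open>The factor \<open>(i + 1)!\<close> turns \<open>i + 2\<close> into
        \<open>(i + 2)!\<close> and splits as \<open>(i + 1) * i!\<close> on the last term, giving
        the weight \<open>(n - i) * (i + 1)\<close>.\<close>
      then have "fact (i + 1) * ((real i + 2) * coeff (q (i + 2)) m) =
          fact (i + 1) * ((case m of 0 \<Rightarrow> 0 | Suc l \<Rightarrow> coeff (q (i + 1)) l)
            - (real n - real i) * coeff (q i) m)"
        by simp
      then have "fact (i + 2) * coeff (q (i + 2)) m =
          (case m of 0 \<Rightarrow> 0 | Suc l \<Rightarrow> fact (i + 1) * coeff (q (i + 1)) l)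
            - (real n - real i) * (real i + 1) * (fact i * coeff (q i) m)"
        by (simp add: algebra_simps split: nat.split)
      also have "\<dots> = real_of_int (sep_coeff (int n) (i + 2) m)"
        unfolding sep_coeff_Suc_Suc using less.IH[of "i + 1"] less.IH[of i] less.prems 3
        by (simp split: nat.split)
      finally show ?thesis by (simp add: 3)
    qed
  qed
  show ?thesis
  proof (intro ballI)
    fix j i assume "j \<in> {0..n}" "i \<in> {0..j}"
    then show "coeff (q j) (j - i) =
             (if odd i then 0
              else (- 1) ^ (i div 2) / fact j
                     * (\<Sum>I\<in>sep_sets (i div 2) (int j). real_of_int (R (int n) I)))"
      using main[of j "j - i"] by (auto simp: sep_coeff_def sep_sum_def field_simps)
  qed
qed

end
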